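(* Let $(X,\mu)$ be an atomless standard probability space, let $\mathbb{Z}\curvearrowright^{S}(X,\mu)$ be an ergodic p.m.p. action, let $(\epsilon_n,T_n,B_n,F_n,\alpha_n,\mathscr{A}_n,C_n)_{n\in\mathbb{N}}$ be a system of towers and column-to-tile maps for $S$ satisfying conditions (a)–(f) of the context, and let $\mathbb{Z}^2\curvearrowright^{R}(X,\mu)$ be the action it induces. Then the orbit equivalence between $\mathbb{Z}\curvearrowright^{S}(X,\mu)$ and $\mathbb{Z}^2\curvearrowright^{R}(X,\mu)$ (given by the identity map of $X$) is Shannon.
   Context: Towers. For finite $T\subset\mathbb{Z}$ and measurable $B\subset X$, the pair $(T,B)$ is a tower of $S$ if the sets $S^mB$, $m\in T$, are pairwise disjoint; write $S^TB=\bigcup_{m\in T}S^mB$. It is an $\epsilon$-tower if moreover $\mu(X\setminus S^TB)<\epsilon$. Column-to-tile maps. Let $(T,B)$ be an $\epsilon$-tower, and let $F\subset\mathbb{Z}^2$ have $|F|=|T|$. Given a finite set $I$, bijections $\phi_i:T\to F$ ($i\in I$), a measurable partition $\mathscr{A}$ of $B$ with $|\mathscr{A}|>|I|$, and a surjection $\sigma:\mathscr{A}\to I$, the map $\alpha:T\times B\to F$ with $\alpha(m,x)=\phi_{\sigma(A)}(m)$ for $x\in A\in\mathscr{A}$ is called a column-to-tile map of $(T,B)$ to $F$ with associated partition $\mathscr{A}$. Assumptions. For every $n\in\mathbb{N}$: (a) $0<\epsilon_n<2^{-n}$; (b) $(T_n,B_n)$ is an $\epsilon_n$-tower of $S$,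 $T_n$ is an interval of nonnegative integers containing $0$, $|T_n|/|T_{n+1}|<\epsilon_{n+1}$, and there is $N$ with $|T_n|<2^{n^3}$ for all $n>N$; (c) $F_n$ is a square centered at the origin in $\mathbb{Z}^2$, $|F_n|=|T_n|$, and $|(F_n+F_{n+1})\setminus F_{n+1}|<\epsilon_{n+1}|F_{n+1}|$; (d) $C_n\subset\mathbb{Z}^2$ is a finite set such that the tiles $F_n+c$, $c\in C_n$, are disjoint with union $F_{n+1}$; (e) $\alpha_n$ is a column-to-tile map of $(T_n,B_n)$ to $F_n$ with associated partition $\mathscr{A}_n$ of $B_n$; and for $n>1$, $A\in\mathscr{A}_n$, $b,b'\in A$ and $m\in T_n$, one has $S^mb\in B_{n-1}$ if and only if $S^mb'\in B_{n-1}$; (f) for $A\in\mathscr{A}_{n+1}$ let $\bar T_{n+1}=\bar T_{n+1}(A)$ be the set of all $i\in T_{n+1}$ with $S^iA\subset B_n$ and $i+T_n\subset T_{n+1}$; then for each $b\in A$ there are distinct elements $c_i\in C_n$ ($i\in\bar T_{n+1}$) such that $\alpha_{n+1}(i+j,b)=\alpha_n(j,S^ib)+c_i$ for all $i\in\bar T_{n+1}$, $j\in T_n$. Induced action. For a standard generator $s\in\{(1,0),(0,1)\}$ and $n\in\mathbb{N}$, let $\sigma_{s,n}$ be the partial map on $S^{T_n}B_n$ with $\sigma_{s,n}(S^tb)=S^{t'}b$ whenever $t,t'\in T_n$, $b\in B_n$ and $\alpha_n(t',b)-\alpha_n(t,b)=s$. For a.e. $x$, $\sigma_{s,n}(x)$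 is defined and independent of $n$ for all large $n$; $R$ is the action of $\mathbb{Z}^2$ with $R^sx=\sigma_{s,n}(x)$ for all large $n$. It is a free p.m.p. action with the same orbits as $S$ a.e. Shannon. The cocycles $\lambda:X\times\mathbb{Z}\to\mathbb{Z}^2$ and $\kappa:X\times\mathbb{Z}^2\to\mathbb{Z}$ are given by $R^{\lambda(x,k)}x=S^kx$ and $S^{\kappa(x,g)}x=R^gx$. The orbit equivalence is Shannon if for all $k\in\mathbb{Z}$ and $g\in\mathbb{Z}^2$ the partitions $\{\{x:\lambda(x,k)=h\}\}_{h\in\mathbb{Z}^2}$ and $\{\{x:\kappa(x,g)=m\}\}_{m\in\mathbb{Z}}$ have finite Shannon entropy, where the entropy of a countable partition $\mathscr{P}$ is $\sum_{P\in\mathscr{P}}-\mu(P)\log\mu(P)$. *)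

theory Defs
  imports "HOL-Analysis.Analysis"
begin

section \<open>Standard probability spaces and p.m.p. actions\<close>

definition standard_prob_space :: "'a measure \<Rightarrow> bool" where
  "standard_prob_space M \<longleftrightarrow>
     emeasure M (space M) = 1 \<and>
     (\<exists>X. topspace X = space M \<and> completely_metrizable_space X \<and> second_countable X \<and>
          sets M = sigma_sets (space M) {U. openin X U})"

definition atomless :: "'a measure \<Rightarrow> bool" where
  "atomless M \<longleftrightarrow>
     (\<forall>A\<in>sets M. 0 < emeasure M A \<longrightarrow>
        (\<exists>B\<in>sets M. B \<subseteq> A \<and> 0 < emeasure M B \<and> emeasure M B < emeasure M A))"

definition pmp_action :: "'a measure \<Rightarrow> ('g::group_add \<Rightarrow> 'a \<Rightarrow> 'a) \<Rightarrow> bool" where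
  "pmp_action M S \<longleftrightarrow>
     (\<forall>g. S g \<in> measurable M M \<and> distr M M (S g) = M) \<and>
     (\<forall>x\<in>space M. S 0 x = x) \<and>
     (\<forall>g h. \<forall>x\<in>space M. S (g + h) x = S g (S h x))"

definition ergodic_action :: "'a measure \<Rightarrow> ('g::group_add \<Rightarrow> 'a \<Rightarrow> 'a) \<Rightarrow> bool" where
  "ergodic_action M S \<longleftrightarrow>
     (\<forall>A\<in>sets M. (\<forall>g. S g -` A \<inter> space M = A) \<longrightarrow> measure M A = 0 \<or> measure M A = 1)"

definition free_action :: "'a measure \<Rightarrow> ('g::group_add \<Rightarrow> 'a \<Rightarrow> 'a) \<Rightarrow> bool" where
  "free_action M S \<longleftrightarrow> (AE x in M. \<forall>g. g \<noteq> 0 \<longrightarrow> S g x \<noteq> x)"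


section \<open>Towers and column-to-tile maps\<close>

definition tower_union :: "(int \<Rightarrow> 'a \<Rightarrow> 'a) \<Rightarrow> int set \<Rightarrow> 'a set \<Rightarrow> 'a set" where
  "tower_union S T B = (\<Union>m\<in>T. S m ` B)"

definition is_tower :: "'a measure \<Rightarrow> (int \<Rightarrow> 'a \<Rightarrow> 'a) \<Rightarrow> int set \<Rightarrow> 'a set \<Rightarrow> bool" where
  "is_tower M S T B \<longleftrightarrow> finite T \<and> B \<in> sets M \<and> disjoint_family_on (\<lambda>m. S m ` B) T"

definition is_eps_tower ::
  "'a measure \<Rightarrow> (int \<Rightarrow> 'a \<Rightarrow> 'a) \<Rightarrow> real \<Rightarrow> int set \<Rightarrow> 'a set \<Rightarrow> bool" where
  "is_eps_tower M S e T B \<longleftrightarrow>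
     is_tower M S T B \<and> measure M (space M - tower_union S T B) < e"

text \<open>
  A measurable partition is a countable one with measurable, nonempty pieces. The finite index set
  \<open>I\<close> is taken inside \<open>nat\<close>, which is no restriction up to relabelling. The cardinality condition
  between \<open>I\<close> and the partition is strict and also makes sense for an infinite partition.
  Only the values of the map on \<open>T\<close> times \<open>B\<close> matter.
\<close>

definition measurable_partition :: "'a measure \<Rightarrow> 'a set \<Rightarrow> 'a set set \<Rightarrow> bool" where
  "measurable_partition M B \<A> \<longleftrightarrow> partition_on B \<A> \<and> countable \<A> \<and> \<A> \<subseteq> sets M"

definition column_to_tile_map ::
  "'a measure \<Rightarrow> int set \<Rightarrow> 'a set \<Rightarrow> (int \<times> int) set \<Rightarrow> 'a set set \<Rightarrow>
   (int \<Rightarrow> 'a \<Rightarrow> int \<times> int) \<Rightarrow> bool" where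
  "column_to_tile_map M T B F \<A> \<alpha> \<longleftrightarrow>
     finite F \<and> card F = card T \<and>
     measurable_partition M B \<A> \<and>
     (\<exists>(I :: nat set) \<phi> \<sigma>.
        finite I \<and> (\<forall>i\<in>I. bij_betw (\<phi> i) T F) \<and>
        I \<prec> \<A> \<and> \<sigma> ` \<A> = I \<and>
        (\<forall>A\<in>\<A>. \<forall>x\<in>A. \<forall>m\<in>T. \<alpha> m x = \<phi> (\<sigma> A) m))"

definition centered_square :: "(int \<times> int) set \<Rightarrow> bool" where
  "centered_square F \<longleftrightarrow> (\<exists>r::nat. F = {- int r..int r} \<times> {- int r..int r})"

definition inner_positions ::
  "(int \<Rightarrow> 'a \<Rightarrow> 'a) \<Rightarrow> int set \<Rightarrow> 'a set \<Rightarrow> int set \<Rightarrow> 'a set \<Rightarrow> int set" where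
  "inner_positions S T B T' A = {i \<in> T'. S i ` A \<subseteq> B \<and> (\<lambda>j. i + j) ` T \<subseteq> T'}"

text \<open>
  All sequences are indexed by the positive integers; their values at \<open>0\<close> are irrelevant.
\<close>

definition tower_system ::
  "'a measure \<Rightarrow> (int \<Rightarrow> 'a \<Rightarrow> 'a) \<Rightarrow> (nat \<Rightarrow> real) \<Rightarrow> (nat \<Rightarrow> int set) \<Rightarrow> (nat \<Rightarrow> 'a set) \<Rightarrow>
   (nat \<Rightarrow> (int \<times> int) set) \<Rightarrow> (nat \<Rightarrow> int \<Rightarrow> 'a \<Rightarrow> int \<times> int) \<Rightarrow> (nat \<Rightarrow> 'a set set) \<Rightarrow>
   (nat \<Rightarrow> (int \<times> int) set) \<Rightarrow> bool" where
  "tower_system M S \<epsilon> T B F \<alpha> \<A> C \<longleftrightarrow>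
     (\<forall>n\<ge>1. 0 < \<epsilon> n \<and> \<epsilon> n < 1 / 2 ^ n) \<and>
     (\<forall>n\<ge>1. is_eps_tower M S (\<epsilon> n) (T n) (B n) \<and>
        (\<exists>b\<ge>0. T n = {0..b}) \<and>
        real (card (T n)) / real (card (T (n + 1))) < \<epsilon> (n + 1)) \<and>
     (\<exists>N. \<forall>n>N. card (T n) < 2 ^ (n ^ 3)) \<and>
     (\<forall>n\<ge>1. centered_square (F n) \<and> card (F n) = card (T n) \<and>
        real (card ({f + f' |f f'. f \<in> F n \<and> f' \<in> F (n + 1)} - F (n + 1)))
          < \<epsilon> (n + 1) * real (card (F (n + 1)))) \<and>
     (\<forall>n\<ge>1. finite (C n) \<and>
        disjoint_family_on (\<lambda>c. (\<lambda>f. f + c) ` F n) (C n) \<and>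
        (\<Union>c\<in>C n. (\<lambda>f. f + c) ` F n) = F (n + 1)) \<and>
     (\<forall>n\<ge>1. column_to_tile_map M (T n) (B n) (F n) (\<A> n) (\<alpha> n)) \<and>
     (\<forall>n>1. \<forall>A\<in>\<A> n. \<forall>b\<in>A. \<forall>b'\<in>A. \<forall>m\<in>T n. S m b \<in> B (n - 1) \<longleftrightarrow> S m b' \<in> B (n - 1)) \<and>
     (\<forall>n\<ge>1. \<forall>A\<in>\<A> (n + 1). \<forall>b\<in>A.
        let J = inner_positions S (T n) (B n) (T (n + 1)) A in
        \<exists>c. inj_on c J \<and> c ` J \<subseteq> C n \<and>
          (\<forall>i\<in>J. \<forall>j\<in>T n. \<alpha> (n + 1) (i + j) b = \<alpha> n j (S i b) + c i))"


section \<open>The induced action\<close>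

text \<open>
  The graph of the partial map that moves a point of the tower \<open>(T, B)\<close> within its column so that
  its position in the tile changes by \<open>s\<close>. It is single-valued, because the levels of the tower
  are disjoint and \<open>\<alpha>\<close> is injective on every column.
\<close>

definition tile_shift ::
  "(int \<Rightarrow> 'a \<Rightarrow> 'a) \<Rightarrow> int set \<Rightarrow> 'a set \<Rightarrow> (int \<Rightarrow> 'a \<Rightarrow> int \<times> int) \<Rightarrow> int \<times> int \<Rightarrow>
   'a \<Rightarrow> 'a \<Rightarrow> bool" where
  "tile_shift S T B \<alpha> s x y \<longleftrightarrow>
     (\<exists>t\<in>T. \<exists>t'\<in>T. \<exists>b\<in>B. x = S t b \<and> y = S t' b \<and> \<alpha> t' b - \<alpha> t b = s)"

text \<open>
  The condition determines the induced action up to a null set.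
\<close>

definition induced_action ::
  "'a measure \<Rightarrow> (int \<Rightarrow> 'a \<Rightarrow> 'a) \<Rightarrow> (nat \<Rightarrow> int set) \<Rightarrow> (nat \<Rightarrow> 'a set) \<Rightarrow>
   (nat \<Rightarrow> int \<Rightarrow> 'a \<Rightarrow> int \<times> int) \<Rightarrow> (int \<times> int \<Rightarrow> 'a \<Rightarrow> 'a) \<Rightarrow> bool" where
  "induced_action M S T B \<alpha> R \<longleftrightarrow>
     pmp_action M R \<and>
     (\<forall>s\<in>{(1, 0), (0, 1)}. AE x in M.
        \<forall>\<^sub>F n in sequentially. tile_shift S (T n) (B n) (\<alpha> n) s x (R s x))"


section \<open>Shannon orbit equivalence\<close>

text \<open>
  The cocycle \<open>c\<close> with \<open>R (c x g) x = S g x\<close>. For an orbit equivalence of free actions \<open>c x g\<close> is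
  unique for almost every \<open>x\<close>; on the remaining null set it is given the value \<open>0\<close>.
\<close>

definition cocycle ::
  "('g \<Rightarrow> 'a \<Rightarrow> 'a) \<Rightarrow> ('h::zero \<Rightarrow> 'a \<Rightarrow> 'a) \<Rightarrow> 'a \<Rightarrow> 'g \<Rightarrow> 'h" where
  "cocycle S R x g = (if \<exists>!h. R h x = S g x then THE h. R h x = S g x else 0)"

definition partition_entropy :: "'a measure \<Rightarrow> ('a \<Rightarrow> 'h) \<Rightarrow> ennreal" where
  "partition_entropy M f =
     (\<Sum>\<^sub>\<infinity>h. ennreal (- measure M {x \<in> space M. f x = h} * ln (measure M {x \<in> space M. f x = h})))"

text \<open>
  The orbit equivalence is the identity map. Measurability of the two cocycles is included because
  \<open>measure\<close> is \<open>0\<close> on nonmeasurable sets, which would make the entropy meaningless.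
\<close>

definition orbit_equivalence_id ::
  "'a measure \<Rightarrow> ('g::group_add \<Rightarrow> 'a \<Rightarrow> 'a) \<Rightarrow> ('h::group_add \<Rightarrow> 'a \<Rightarrow> 'a) \<Rightarrow> bool" where
  "orbit_equivalence_id M S R \<longleftrightarrow>
     free_action M S \<and> free_action M R \<and>
     (AE x in M. range (\<lambda>g. S g x) = range (\<lambda>h. R h x))"

definition shannon_orbit_equivalence_id ::
  "'a measure \<Rightarrow> ('g::group_add \<Rightarrow> 'a \<Rightarrow> 'a) \<Rightarrow> ('h::group_add \<Rightarrow> 'a \<Rightarrow> 'a) \<Rightarrow> bool" where
  "shannon_orbit_equivalence_id M S R \<longleftrightarrow>
     orbit_equivalence_id M S R \<and>
     (\<forall>g. (\<lambda>x. cocycle S R x g) \<in> measurable M (count_space UNIV) \<and>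
          partition_entropy M (\<lambda>x. cocycle S R x g) < \<infinity>) \<and>
     (\<forall>h. (\<lambda>x. cocycle R S x h) \<in> measurable M (count_space UNIV) \<and>
          partition_entropy M (\<lambda>x. cocycle R S x h) < \<infinity>)"

end

theory Submission
  imports Defs "HOL-Probability.Probability_Measure" "HOL-Real_Asymp.Real_Asymp"
begin

text \<open>
  By the tower estimates and (b), almost every point eventually lies in a column of the \<open>n\<close>-th tower
  which is a complete segment of a column of the next one; the exceptional set at stage \<open>n\<close> has
  measure \<open>O(2\<^sup>-\<^sup>n)\<close>. By (f) the difference of the labels of two points of such a column
  does not change from then on, so it equals the value of the cocycle. For a fixed group element,
  a point stays in its column or tile unless it is close to the boundary, which again
  has probability \<open>O(2\<^sup>-\<^sup>n)\<close>. Hence, outside a set of measure \<open>O(2\<^sup>-\<^sup>n)\<close>, both cocycles take at most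
  \<open>|T n|\<^sup>2\<close> values, whose logarithm is \<open>O(n\<^sup>3)\<close>, and the entropies are finite because
  \<open>n\<^sup>3 / 2\<^sup>n\<close> is summable.
\<close>

section \<open>Entropy of a countable partition\<close>

text \<open>The inequality ln y \<le> y - 1 at y = w / p, multiplied by p. Summed over a partition
  it is Gibbs' inequality, in a form valid for weights of any total mass.\<close>

lemma neg_mult_ln_le:
  fixes p w :: real
  assumes "0 \<le> p" "0 < w"
  shows "- p * ln p \<le> w - p * ln w"
proof (cases "p = 0")
  case False
  then have p: "p > 0" using assms by simp
  have "p * ln (w / p) \<le> p * (w / p - 1)"
    using p assms ln_le_minus_one[of "w / p"] by (intro mult_left_mono) auto
  moreover have "ln (w / p) = ln w - ln p" using p assms by (simp add: ln_div)
  moreover have "p * (w / p - 1) = w - p" using p by (simp add: field_simps)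
  ultimately show ?thesis using p by (simp add: algebra_simps)
qed (use assms in auto)

lemma le_div_power2_imp_0:
  fixes p Q :: real
  assumes "0 \<le> p" "\<And>n. n > N \<Longrightarrow> p \<le> Q / 2 ^ n"
  shows "p = 0"
proof -
  have "(\<lambda>n. Q / 2 ^ n) \<longlonglongrightarrow> 0" by real_asymp
  moreover have "\<forall>\<^sub>F n in sequentially. p \<le> Q / 2 ^ n"
    using assms(2) by (auto simp: eventually_sequentially intro!: exI[of _ "Suc N"])
  ultimately have "p \<le> 0" by (intro tendsto_lowerbound) auto
  with assms(1) show ?thesis by simp
qed

text \<open>Gibbs' inequality is applied with the weight \<open>2 ^ - (n + c n)\<close> on the values that first
  appear in \<open>V n\<close>.\<close>

lemma (in prob_space) partition_entropy_finite:
  fixes f :: "'a \<Rightarrow> 'h" and V :: "nat \<Rightarrow> 'h set" and c :: "nat \<Rightarrow> nat"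
  assumes f: "f \<in> measurable M (count_space UNIV)"
    and V: "\<And>n. finite (V n)" "\<And>n. card (V n) \<le> 2 ^ c n"
    and c: "summable (\<lambda>n. real (c n) / 2 ^ n)"
    and Q: "\<And>n. prob {x \<in> space M. f x \<notin> V n} \<le> Q / 2 ^ n"
  shows "partition_entropy M f < \<infinity>"
proof -
  define p where "p h = prob {x \<in> space M. f x = h}" for h
  \<comment> \<open>The sets \<open>V n\<close> need not increase, so a value is assigned to the
    first level that contains it. Values in no \<open>V n\<close> are null and are removed
    below.\<close>
  define \<nu> where "\<nu> h = (LEAST n. h \<in> V n)" for h
  \<comment> \<open>At least 1, so that the same constant covers level 0, where only the trivial
    mass bound 1 is available.\<close>
  define P where "P = max 1 Q"
  \<comment> \<open>Bound for the entropy of level n: at most \<open>2 ^ c n\<close> weights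
    \<open>w = 1 / 2 ^ (n + c n)\<close> give the first term; the mass \<open>2 * P / 2 ^ n\<close>
    times - ln w \<le> n + c n gives the second.\<close>
  define a where "a n = 1 / 2 ^ n + 2 * P * (real n + real (c n)) / 2 ^ n" for n :: nat
  have [measurable]: "{x \<in> space M. f x \<in> Z} \<in> sets M" for Z
  proof -
    have "f -` Z \<inter> space M \<in> sets M" using f by (rule measurable_sets) simp
    moreover have "f -` Z \<inter> space M = {x \<in> space M. f x \<in> Z}" by auto
    ultimately show ?thesis by simp
  qed
  have [measurable]: "{x \<in> space M. f x \<notin> Z} \<in> sets M" for Z
    using \<open>\<And>Z. {x \<in> space M. f x \<in> Z} \<in> sets M\<close>[of "- Z"] by simp
  have p_nonneg: "0 \<le> p h" for h by (simp add: p_def)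
  have P: "P \<ge> 1" "P \<ge> Q" by (auto simp: P_def)
  have p_zero: "p h = 0" if "\<And>n. h \<notin> V n" for h
  proof (rule le_div_power2_imp_0)
    show "p h \<le> Q / 2 ^ n" for n
      unfolding p_def by (rule order_trans[OF _ Q], rule finite_measure_mono) (use that in auto)
  qed (rule p_nonneg)
  have mass: "(\<Sum>h\<in>H. p h) = prob {x \<in> space M. f x \<in> H}" if "finite H" for H
  proof -
    have "{x \<in> space M. f x = h} \<in> sets M" for h
      using \<open>\<And>Z. {x \<in> space M. f x \<in> Z} \<in> sets M\<close>[of "{h}"] by simp
    then have "prob (\<Union>h\<in>H. {x \<in> space M. f x = h}) = (\<Sum>h\<in>H. p h)"
      unfolding p_def using that
      by (intro finite_measure_finite_Union) (auto simp: disjoint_family_on_def)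
    moreover have "(\<Union>h\<in>H. {x \<in> space M. f x = h}) = {x \<in> space M. f x \<in> H}" by auto
    ultimately show ?thesis by simp
  qed
  have sum_a: "summable a"
  proof -
    have "summable (\<lambda>n. 1 / 2 ^ n :: real)"
      using summable_geometric[of "1 / 2 :: real"] by (simp add: power_divide)
    moreover have "summable (\<lambda>n. real n / 2 ^ n)"
    proof (rule summable_comparison_test_bigo)
      show "summable (\<lambda>n. norm (inverse (real n ^ 2)))"
        using inverse_power_summable[of 2, where ?'a = real] by simp
      show "(\<lambda>n. real n / 2 ^ n) \<in> O(\<lambda>n. inverse (real n ^ 2))"
        by real_asymp
    qed
    ultimately have "summable (\<lambda>n. 1 / 2 ^ n + 2 * P * (real n / 2 ^ n + real (c n) / 2 ^ n))"
      using c by (intro summable_add summable_mult)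
    then show ?thesis unfolding a_def by (simp only: add_divide_distrib[symmetric] times_divide_eq_right)
  qed
  have a_nonneg: "0 \<le> a n" for n using P by (simp add: a_def)
  have bound: "(\<Sum>h\<in>H. - p h * ln (p h)) \<le> suminf a" if H: "finite H" for H
  proof -
    define H' where "H' = {h \<in> H. \<exists>n. h \<in> V n}"
    have H': "finite H'" using H by (simp add: H'_def)
    have level: "(\<Sum>h\<in>{h \<in> H'. \<nu> h = n}. - p h * ln (p h)) \<le> a n" for n
    proof -
      define K where "K = {h \<in> H'. \<nu> h = n}"
      define w :: real where "w = 1 / 2 ^ (n + c n)"
      have K: "finite K" using H' by (simp add: K_def)
      have "K \<subseteq> V n" by (auto simp: K_def H'_def \<nu>_def intro: LeastI)
      then have "card K \<le> 2 ^ c n" using V card_mono order_trans by metis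
      then have cardK: "real (card K) \<le> 2 ^ c n"
        by (metis of_nat_le_iff of_nat_numeral of_nat_power)
      have w: "w > 0" "ln w = - (real n + real (c n)) * ln 2"
        by (simp_all add: w_def ln_div ln_realpow power_add ln_mult algebra_simps)
      \<comment> \<open>A value first seen at level m + 1 avoids \<open>V m\<close>; this shift by
        one level accounts for the factor 2.\<close>
      have massK: "(\<Sum>h\<in>K. p h) \<le> 2 * P / 2 ^ n"
      proof (cases n)
        case 0
        then show ?thesis
          unfolding mass[OF K] using P order_trans[OF prob_le_1, of "2 * P"] by simp
      next
        case (Suc m)
        have "h \<notin> V m" if "h \<in> K" for h
          using that not_less_Least[of m "\<lambda>n. h \<in> V n"] Suc by (auto simp: K_def \<nu>_def)
        then have "(\<Sum>h\<in>K. p h) \<le> prob {x \<in> space M. f x \<notin> V m}"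
          unfolding mass[OF K] by (intro finite_measure_mono) auto
        also have "\<dots> \<le> P / 2 ^ m"
          using Q[of m] P by (smt (verit) divide_right_mono zero_le_power)
        finally show ?thesis using Suc by simp
      qed
      have "(\<Sum>h\<in>K. - p h * ln (p h)) \<le> (\<Sum>h\<in>K. w - p h * ln w)"
        using w p_nonneg by (intro sum_mono neg_mult_ln_le)
      also have "\<dots> = real (card K) * w - (\<Sum>h\<in>K. p h) * ln w"
        by (simp add: sum_subtractf sum_distrib_right)
      also have "\<dots> = real (card K) * w + (\<Sum>h\<in>K. p h) * ((real n + real (c n)) * ln 2)"
        by (simp add: w algebra_simps)
      also have "\<dots> \<le> 2 ^ c n * w + (2 * P / 2 ^ n) * ((real n + real (c n)) * 1)"
        using cardK w massK P ln_2_less_1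
        by (intro add_mono mult_mono mult_right_mono mult_left_mono sum_nonneg p_nonneg) auto
      also have "\<dots> = a n" by (simp add: a_def w_def power_add)
      finally show ?thesis by (simp add: K_def)
    qed
    have "(\<Sum>h\<in>H. - p h * ln (p h)) = (\<Sum>h\<in>H'. - p h * ln (p h))"
      using H p_zero by (intro sum.mono_neutral_right) (auto simp: H'_def)
    also have "\<dots> = (\<Sum>n\<in>\<nu> ` H'. \<Sum>h\<in>{h \<in> H'. \<nu> h = n}. - p h * ln (p h))"
      using H' by (intro sum.group[symmetric]) auto
    also have "\<dots> \<le> (\<Sum>n\<in>\<nu> ` H'. a n)" using level by (intro sum_mono)
    also have "\<dots> \<le> suminf a" using sum_a H' a_nonneg by (intro sum_le_suminf) auto
    finally show ?thesis .
  qed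
  have "partition_entropy M f \<le> ennreal (suminf a)"
    unfolding partition_entropy_def p_def[symmetric]
  proof (rule infsum_le_finite_sums)
    fix H :: "'h set" assume H: "finite H"
    \<comment> \<open>Without nonnegative terms \<open>ennreal\<close> would truncate and not
      commute with the finite sum.\<close>
    have nonneg: "0 \<le> - p h * ln (p h)" for h
    proof -
      have "p h \<le> 1" by (simp add: p_def)
      then have "p h = 0 \<or> ln (p h) \<le> 0"
        using p_nonneg[of h] by (metis less_eq_real_def ln_le_zero_iff)
      then show ?thesis using p_nonneg[of h] by (auto intro: mult_nonneg_nonpos)
    qed
    have "(\<Sum>h\<in>H. ennreal (- p h * ln (p h))) = ennreal (\<Sum>h\<in>H. - p h * ln (p h))"
      using nonneg by (intro sum_ennreal) auto
    also have "\<dots> \<le> ennreal (suminf a)" using bound[OF H] by (intro ennreal_leI)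
    finally show "(\<Sum>h\<in>H. ennreal (- p h * ln (p h))) \<le> ennreal (suminf a)" .
  qed (simp add: nonneg_summable_on_complete)
  then show ?thesis by (simp add: le_less_trans)
qed

section \<open>Probability measure preserving actions\<close>

context
  fixes M :: "'a measure" and S :: "'g::group_add \<Rightarrow> 'a \<Rightarrow> 'a"
  assumes S: "pmp_action M S"
begin

lemma pmp_measurable: "S g \<in> measurable M M"
  using S by (simp add: pmp_action_def)

lemma pmp_space: "x \<in> space M \<Longrightarrow> S g x \<in> space M"
  using measurable_space[OF pmp_measurable] .

lemma pmp_add: "x \<in> space M \<Longrightarrow> S (g + h) x = S g (S h x)"
  using S by (simp add: pmp_action_def)

lemma pmp_zero: "x \<in> space M \<Longrightarrow> S 0 x = x"
  using S by (simp add: pmp_action_def)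

lemma pmp_inverse: "x \<in> space M \<Longrightarrow> S (- g) (S g x) = x" "x \<in> space M \<Longrightarrow> S g (S (- g) x) = x"
  by (simp_all add: pmp_add[symmetric] pmp_zero)

text \<open>Preimages of null sets are null. This allows an almost sure property to be used at a
  translated point.\<close>

lemma pmp_AE: "AE x in M. P x \<Longrightarrow> AE x in M. P (S g x)"
proof -
  assume P: "AE x in M. P x"
  have "distr M M (S g) = M" using S by (simp add: pmp_action_def)
  with P have "AE x in distr M M (S g). P x" by (simp only:)
  then show ?thesis by (rule AE_distrD[OF pmp_measurable])
qed

text \<open>Towers are built from images, while measurability and invariance speak of preimages;
  invertibility of the action links the two.\<close>

lemma pmp_image_eq_vimage:
  assumes "A \<in> sets M"
  shows "S g ` A = S (- g) -` A \<inter> space M"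
proof (intro equalityI subsetI)
  fix y assume "y \<in> S g ` A"
  then obtain x where x: "x \<in> A" "y = S g x" by auto
  then have "x \<in> space M" using assms sets.sets_into_space by auto
  then show "y \<in> S (- g) -` A \<inter> space M"
    using x by (simp add: pmp_inverse pmp_space)
next
  fix y assume "y \<in> S (- g) -` A \<inter> space M"
  then have "y = S g (S (- g) y)" "S (- g) y \<in> A" by (simp_all add: pmp_inverse)
  then show "y \<in> S g ` A" by (rule image_eqI)
qed

lemma pmp_image_sets: "A \<in> sets M \<Longrightarrow> S g ` A \<in> sets M"
  using pmp_image_eq_vimage measurable_sets[OF pmp_measurable] by simp

lemma pmp_measure_image:
  assumes "A \<in> sets M"
  shows "measure M (S g ` A) = measure M A"
proof -
  have "distr M M (S (- g)) = M" using S by (simp add: pmp_action_def)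
  then have "measure M A = measure (distr M M (S (- g))) A" by simp
  also have "\<dots> = measure M (S (- g) -` A \<inter> space M)"
    using assms by (intro measure_distr pmp_measurable)
  finally show ?thesis using assms by (simp add: pmp_image_eq_vimage)
qed

text \<open>At a point with trivial stabiliser the group element is recovered from the image, which
  makes the cocycle well defined there.\<close>

lemma pmp_free_inj:
  assumes x: "x \<in> space M" and free: "\<forall>g. g \<noteq> 0 \<longrightarrow> S g x \<noteq> x" and eq: "S g x = S h x"
  shows "g = h"
proof -
  have "S (- h + g) x = x" using x eq by (simp add: pmp_add pmp_inverse)
  then have "- h + g = 0" using free by blast
  then show ?thesis by (simp add: neg_eq_iff_add_eq_0[symmetric])
qed

end

section \<open>Measurability of the cocycles\<close>

text \<open>A countable base of a T1 topology separates points, so the set where f and g differ is a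
  countable union of the sets \<open>f x \<in> V\<close>, \<open>g x \<notin> V\<close>.\<close>

lemma standard_sets_eq_measurable:
  assumes std: "standard_prob_space M"
    and f: "f \<in> measurable N M" and g: "g \<in> measurable N M"
  shows "{x \<in> space N. f x = g x} \<in> sets N"
proof -
  obtain X where X: "topspace X = space M" "completely_metrizable_space X" "second_countable X"
    and sets: "sets M = sigma_sets (space M) {U. openin X U}"
    using std by (auto simp: standard_prob_space_def)
  obtain \<B> where \<B>: "countable \<B>" "\<And>V. V \<in> \<B> \<Longrightarrow> openin X V"
    and base: "\<And>U x. openin X U \<Longrightarrow> x \<in> U \<Longrightarrow> \<exists>V\<in>\<B>. x \<in> V \<and> V \<subseteq> U"
    using X(3) unfolding second_countable_def by metis
  have T1: "t1_space X"
    using X(2) completely_metrizable_imp_metrizable_space metrizable_imp_Hausdorff_space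
      Hausdorff_imp_t1_space by blast
  have meas: "V \<in> sets M" if "V \<in> \<B>" for V
    using \<B>(2)[OF that] sets by (auto intro: sigma_sets.Basic)
  have sep: "\<exists>V\<in>\<B>. f x \<in> V \<and> g x \<notin> V" if "x \<in> space N" and neq: "f x \<noteq> g x" for x
  proof -
    have "f x \<in> topspace X" "g x \<in> topspace X"
      using that f g X(1) by (auto dest: measurable_space)
    then obtain U where "openin X U" "f x \<in> U" "g x \<notin> U"
      using T1 neq unfolding t1_space_def by metis
    then show ?thesis using base by blast
  qed
  have "{x \<in> space N. f x = g x} =
      space N - (\<Union>V\<in>\<B>. (f -` V \<inter> space N) - (g -` V \<inter> space N))"
    using sep by auto
  also have "\<dots> \<in> sets N"
    using \<B>(1) meas measurable_sets[OF f] measurable_sets[OF g]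
    by (intro sets.compl_sets sets.countable_UN' sets.Diff) auto
  finally show ?thesis .
qed

text \<open>The group acting through \<open>R\<close> is countable, so unique solvability of
  \<open>R h x = S g x\<close> is a countable Boolean combination of measurable conditions.\<close>

lemma cocycle_measurable:
  fixes S :: "'g::group_add \<Rightarrow> 'a \<Rightarrow> 'a" and R :: "'h::{group_add,countable} \<Rightarrow> 'a \<Rightarrow> 'a"
  assumes std: "standard_prob_space M" and S: "pmp_action M S" and R: "pmp_action M R"
  shows "(\<lambda>x. cocycle S R x g) \<in> measurable M (count_space UNIV)"
proof -
  have [measurable]: "Measurable.pred M (\<lambda>x. R h x = S g x)" for h
    unfolding pred_def
    using standard_sets_eq_measurable[OF std pmp_measurable[OF R] pmp_measurable[OF S]] .
  \<comment> \<open>The second disjunct is the default value 0 at points without a unique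
    solution.\<close>
  have eq: "cocycle S R x g = h \<longleftrightarrow>
      (R h x = S g x \<and> (\<forall>h'. R h' x = S g x \<longrightarrow> h' = h)) \<or>
      (h = 0 \<and> \<not> (\<exists>h. R h x = S g x \<and> (\<forall>h'. R h' x = S g x \<longrightarrow> h' = h)))" for x h
  proof (cases "\<exists>!h. R h x = S g x")
    case True
    then obtain h0 where h0: "R h0 x = S g x" "\<And>h'. R h' x = S g x \<Longrightarrow> h' = h0" by auto
    have "cocycle S R x g = h0"
      using True h0(1) by (simp only: cocycle_def if_True the1_equality)
    then show ?thesis using h0 by metis
  next
    case False
    then have "cocycle S R x g = 0" by (simp only: cocycle_def if_False)
    then show ?thesis using False by metis
  qed
  have "Measurable.pred M (\<lambda>x. cocycle S R x g = h)" for h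
    unfolding eq by measurable
  then have "(\<lambda>x. cocycle S R x g) -` {h} \<inter> space M \<in> sets M" for h
    by (simp add: pred_def vimage_def Int_def conj_commute)
  then show ?thesis
    by (intro measurable_count_space_eq2_countable[THEN iffD2]) auto
qed

lemma cocycle_eqI:
  assumes "R h x = S g x" "\<And>h'. R h' x = S g x \<Longrightarrow> h' = h"
  shows "cocycle S R x g = h"
proof -
  have "\<exists>!h. R h x = S g x" using assms by auto
  then show ?thesis using assms(1) by (simp only: cocycle_def if_True the1_equality)
qed

section \<open>Towers and their columns\<close>

text \<open>The points that leave lie in an end segment of length |k|, on the right for k \<ge> 0
  and on the left otherwise.\<close>

lemma card_shift_out_le:
  fixes a b k :: int
  shows "card {u \<in> {a..b}. u + k \<notin> {a..b}} \<le> nat \<bar>k\<bar>"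
proof -
  have "card {u \<in> {a..b}. u + k \<notin> {a..b}} \<le> card (if 0 \<le> k then {b - k<..b} else {a..<a - k})"
    by (intro card_mono) auto
  also have "\<dots> \<le> nat \<bar>k\<bar>" by auto
  finally show ?thesis .
qed

text \<open>A point leaves the square only if one coordinate leaves the side interval. Each
  coordinate of g costs at most its absolute value times the side length, and the side length is the
  square root of \<open>card F\<close>.\<close>

lemma card_square_shift_out_le:
  fixes g :: "int \<times> int"
  assumes F: "centered_square F"
  shows "real (card {f \<in> F. f + g \<notin> F}) \<le> real (nat (\<bar>fst g\<bar> + \<bar>snd g\<bar>)) * sqrt (real (card F))"
proof -
  obtain r :: nat where r: "F = {- int r..int r} \<times> {- int r..int r}"
    using F by (auto simp: centered_square_def)
  define I where "I = {- int r..int r}"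
  have F_eq: "F = I \<times> I" by (simp add: r I_def)
  have sqrt_F: "sqrt (real (card F)) = real (card I)"
    by (simp add: F_eq card_cartesian_product)
  have I: "finite I" by (simp add: I_def)
  have "{f \<in> F. f + g \<notin> F} \<subseteq> {u \<in> I. u + fst g \<notin> I} \<times> I \<union> I \<times> {u \<in> I. u + snd g \<notin> I}"
    by (cases g) (auto simp: F_eq)
  then have "card {f \<in> F. f + g \<notin> F} \<le>
      card ({u \<in> I. u + fst g \<notin> I} \<times> I \<union> I \<times> {u \<in> I. u + snd g \<notin> I})"
    using I by (intro card_mono) auto
  also have "\<dots> \<le> card {u \<in> I. u + fst g \<notin> I} * card I + card I * card {u \<in> I. u + snd g \<notin> I}"
    using card_Un_le[of "{u \<in> I. u + fst g \<notin> I} \<times> I" "I \<times> {u \<in> I. u + snd g \<notin> I}"]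
    by (simp only: card_cartesian_product)
  also have "\<dots> \<le> nat \<bar>fst g\<bar> * card I + card I * nat \<bar>snd g\<bar>"
    using card_shift_out_le unfolding I_def by (intro add_mono mult_mono) auto
  also have "\<dots> = nat (\<bar>fst g\<bar> + \<bar>snd g\<bar>) * card I"
    by (simp add: nat_add_distrib algebra_simps)
  finally show ?thesis unfolding sqrt_F of_nat_mult[symmetric] by (rule of_nat_mono)
qed

locale tower_tiling = prob_space M for M :: "'a measure" +
  fixes S :: "int \<Rightarrow> 'a \<Rightarrow> 'a"
    and \<epsilon> :: "nat \<Rightarrow> real"
    and T :: "nat \<Rightarrow> int set"
    and B :: "nat \<Rightarrow> 'a set"
    and F :: "nat \<Rightarrow> (int \<times> int) set"
    and \<alpha> :: "nat \<Rightarrow> int \<Rightarrow> 'a \<Rightarrow> int \<times> int"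
    and \<A> :: "nat \<Rightarrow> 'a set set"
    and C :: "nat \<Rightarrow> (int \<times> int) set"
  assumes S: "pmp_action M S"
    and sys: "tower_system M S \<epsilon> T B F \<alpha> \<A> C"
begin

lemmas sys_conj = sys[unfolded tower_system_def]
lemmas sys_conj2 = sys_conj[THEN conjunct2, THEN conjunct2]
lemmas sys_conj5 = sys_conj2[THEN conjunct2, THEN conjunct2, THEN conjunct2]
text \<open>Names follow the conditions: \<open>sys_b'\<close> is the growth bound in (b),
  \<open>sys_e'\<close> the constancy of base visits on atoms in (e).\<close>

lemmas sys_a = sys_conj[THEN conjunct1]
  and sys_b = sys_conj[THEN conjunct2, THEN conjunct1]
  and sys_b' = sys_conj2[THEN conjunct1]
  and sys_c = sys_conj2[THEN conjunct2, THEN conjunct1]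
  and sys_e = sys_conj5[THEN conjunct1]
  and sys_e' = sys_conj5[THEN conjunct2, THEN conjunct1]
  and sys_f = sys_conj5[THEN conjunct2, THEN conjunct2]

lemma \<epsilon>_less: "n \<ge> 1 \<Longrightarrow> \<epsilon> n < 1 / 2 ^ n"
  using sys_a by blast

lemma eps_tower: "n \<ge> 1 \<Longrightarrow> is_eps_tower M S (\<epsilon> n) (T n) (B n)"
  using sys_b by blast

lemma finite_T: "n \<ge> 1 \<Longrightarrow> finite (T n)"
  using eps_tower by (auto simp: is_eps_tower_def is_tower_def)

lemma B_sets: "n \<ge> 1 \<Longrightarrow> B n \<in> sets M"
  using eps_tower by (auto simp: is_eps_tower_def is_tower_def)

lemma B_space: "n \<ge> 1 \<Longrightarrow> b \<in> B n \<Longrightarrow> b \<in> space M"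
  using B_sets sets.sets_into_space by blast

lemma T_mem:
  assumes "n \<ge> 1"
  shows "t \<in> T n \<longleftrightarrow> 0 \<le> t \<and> t < int (card (T n))"
proof -
  obtain b where "b \<ge> 0" "T n = {0..b}"
    using sys_b assms by blast
  then show ?thesis by auto
qed

lemma card_T_pos:
  assumes "n \<ge> 1"
  shows "card (T n) > 0"
proof -
  obtain b where "b \<ge> 0" "T n = {0..b}"
    using sys_b assms by blast
  then show ?thesis by simp
qed

lemma card_T_ratio: "n \<ge> 1 \<Longrightarrow> real (card (T n)) / real (card (T (n + 1))) < \<epsilon> (n + 1)"
  using sys_b by blast

text \<open>By (b) the ratio of successive heights is below 1 / 2^(n+1) \<le> 1/4. The bound serves
  as 2^n \<le> 2 sqrt |T n|, which makes boundary proportions exponentially small.\<close>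

lemma card_T_ge: "n \<ge> 1 \<Longrightarrow> 4 ^ n \<le> 4 * real (card (T n))"
proof (induction n rule: dec_induct)
  case base
  show ?case using card_T_pos[of 1] by simp
next
  case (step n)
  have "real (card (T n)) / real (card (T (n + 1))) < 1 / 2 ^ (n + 1)"
    using card_T_ratio \<epsilon>_less[of "n + 1"] step(1) by fastforce
  also have "\<dots> \<le> 1 / 2 ^ 2"
    using step(1) by (intro divide_left_mono power_increasing) auto
  finally have "4 * real (card (T n)) \<le> real (card (T (n + 1)))"
    using card_T_pos[of "n + 1"] by (simp add: field_simps)
  with step.IH show ?case unfolding Suc_eq_plus1[symmetric] power_Suc by linarith
qed

lemma card_T_bound: "\<exists>N. \<forall>n>N. card (T n) < 2 ^ (n ^ 3)"
  using sys_b' .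

lemma F_square: "n \<ge> 1 \<Longrightarrow> centered_square (F n)"
  using sys_c by blast

lemma card_F: "n \<ge> 1 \<Longrightarrow> card (F n) = card (T n)"
  using sys_c by blast

lemma finite_F: "n \<ge> 1 \<Longrightarrow> finite (F n)"
  using F_square[of n] by (auto simp: centered_square_def)

lemma column_map: "n \<ge> 1 \<Longrightarrow> column_to_tile_map M (T n) (B n) (F n) (\<A> n) (\<alpha> n)"
  using sys_e by blast

lemma partition_\<A>: "n \<ge> 1 \<Longrightarrow> partition_on (B n) (\<A> n)"
  and countable_\<A>: "n \<ge> 1 \<Longrightarrow> countable (\<A> n)"
  and \<A>_sets: "n \<ge> 1 \<Longrightarrow> \<A> n \<subseteq> sets M"
  using column_map by (auto simp: column_to_tile_map_def measurable_partition_def)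

lemma obtain_atom:
  assumes "n \<ge> 1" "b \<in> B n"
  obtains A where "A \<in> \<A> n" "b \<in> A"
  using partition_\<A>[OF assms(1)] assms(2) by (auto simp: partition_on_def)

lemma \<alpha>_const:
  assumes "n \<ge> 1" "A \<in> \<A> n" "b \<in> A" "b' \<in> A" "t \<in> T n"
  shows "\<alpha> n t b = \<alpha> n t b'"
proof -
  obtain \<phi> :: "nat \<Rightarrow> _" and \<sigma> where "\<forall>A\<in>\<A> n. \<forall>x\<in>A. \<forall>m\<in>T n. \<alpha> n m x = \<phi> (\<sigma> A) m"
    using column_map[OF assms(1)] unfolding column_to_tile_map_def by blast
  then show ?thesis using assms by simp
qed

lemma \<alpha>_bij:
  assumes "n \<ge> 1" "b \<in> B n"
  shows "bij_betw (\<lambda>t. \<alpha> n t b) (T n) (F n)"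
proof -
  obtain A where A: "A \<in> \<A> n" "b \<in> A" using obtain_atom assms by blast
  obtain I :: "nat set" and \<phi> \<sigma> where *: "\<forall>i\<in>I. bij_betw (\<phi> i) (T n) (F n)" "\<sigma> ` \<A> n = I"
      "\<forall>A\<in>\<A> n. \<forall>x\<in>A. \<forall>m\<in>T n. \<alpha> n m x = \<phi> (\<sigma> A) m"
    using column_map[OF assms(1)] unfolding column_to_tile_map_def by metis
  then have "bij_betw (\<phi> (\<sigma> A)) (T n) (F n)" using A by blast
  moreover have "\<alpha> n t b = \<phi> (\<sigma> A) t" if "t \<in> T n" for t using *(3) A that by blast
  ultimately show ?thesis by (simp cong: bij_betw_cong)
qed

text \<open>Disjointness of the levels fixes the level, and invertibility of \<open>S t\<close> then
  fixes the base point.\<close>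

lemma column_unique:
  assumes n: "n \<ge> 1" and b: "b \<in> B n" "b' \<in> B n" and t: "t \<in> T n" "t' \<in> T n" and eq: "S t b = S t' b'"
  shows "t = t'" "b = b'"
proof -
  have "disjoint_family_on (\<lambda>m. S m ` B n) (T n)"
    using eps_tower[OF n] by (auto simp: is_eps_tower_def is_tower_def)
  then show t_eq: "t = t'" using b t eq unfolding disjoint_family_on_def by blast
  show "b = b'" using eq b t_eq pmp_inverse(1)[OF S B_space[OF n]] by metis
qed

text \<open>By (e) the whole atom of \<open>b\<close> visits \<open>B n\<close> at time
  \<open>i\<close> as soon as \<open>b\<close> does. So \<open>i\<close> is an inner position in the
  sense of (f), and \<open>c\<close> is the translation that (f) assigns to it.\<close>

lemma refinement:
  assumes n: "n \<ge> 1" and b: "b \<in> B (n + 1)" and i: "0 \<le> i" "i + int (card (T n)) \<le> int (card (T (n + 1)))"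
    and hit: "S i b \<in> B n"
  obtains c where "\<And>j. j \<in> T n \<Longrightarrow> \<alpha> (n + 1) (i + j) b = \<alpha> n j (S i b) + c"
proof -
  obtain A where A: "A \<in> \<A> (n + 1)" "b \<in> A" using obtain_atom[of "n + 1"] b by auto
  have iT: "i \<in> T (n + 1)" using i card_T_pos[OF n] by (simp add: T_mem)
  have "S i a \<in> B n" if "a \<in> A" for a
    using sys_e'[rule_format, of "n + 1" A b a i] n A iT hit that by simp
  then have "S i ` A \<subseteq> B n" by blast
  moreover have "(\<lambda>j. i + j) ` T n \<subseteq> T (n + 1)"
    using i n by (auto simp: T_mem)
  ultimately have inner: "i \<in> inner_positions S (T n) (B n) (T (n + 1)) A"
    using iT by (simp add: inner_positions_def)
  obtain c where "\<forall>i\<in>inner_positions S (T n) (B n) (T (n + 1)) A. \<forall>j\<in>T n.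
      \<alpha> (n + 1) (i + j) b = \<alpha> n j (S i b) + c i"
    using sys_f[rule_format, OF n A] unfolding Let_def by blast
  with inner show ?thesis by (intro that[of "c i"]) blast
qed

section \<open>Sets described by tower coordinates\<close>

text \<open>As tower coordinates are unique, for n \<ge> 1 these are exactly the tower points whose
  level and base point satisfy \<open>Q\<close>.\<close>

definition cells :: "nat \<Rightarrow> (int \<Rightarrow> 'a \<Rightarrow> bool) \<Rightarrow> 'a set" where
  "cells n Q = (\<Union>t\<in>T n. S t ` {b \<in> B n. Q t b})"

lemma cellsE:
  assumes "x \<in> cells n Q"
  obtains t b where "t \<in> T n" "b \<in> B n" "x = S t b" "Q t b"
  using assms by (auto simp: cells_def)

text \<open>Since \<open>Q\<close> is constant on atoms, each level contributes the image of a
  countable union of atoms. The complement is covered by the points outside the tower, of measure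
  below \<open>\<epsilon> n\<close>, and those at bad levels. Integrating the number of bad levels
  over the base bounds the latter by k times the measure of the base, and |T n| disjoint copies of
  the base fit into measure 1.\<close>

lemma
  assumes n: "n \<ge> 1"
    and const: "\<And>A b b' t. A \<in> \<A> n \<Longrightarrow> b \<in> A \<Longrightarrow> b' \<in> A \<Longrightarrow> t \<in> T n \<Longrightarrow> Q t b = Q t b'"
  shows cells_sets: "cells n Q \<in> sets M"
    and prob_not_cells: "(\<And>b. b \<in> B n \<Longrightarrow> real (card {t \<in> T n. \<not> Q t b}) \<le> k) \<Longrightarrow>
      prob (space M - cells n Q) \<le> 1 / 2 ^ n + k / card (T n)"
proof -
  have base: "{b \<in> B n. P b} \<in> sets M" if "\<And>A b b'. A \<in> \<A> n \<Longrightarrow> b \<in> A \<Longrightarrow> b' \<in> A \<Longrightarrow> P b = P b'" for P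
  proof -
    have "{b \<in> B n. P b} = \<Union>{A \<in> \<A> n. \<exists>b\<in>A. P b}"
    proof (intro equalityI subsetI)
      fix x assume "x \<in> {b \<in> B n. P b}"
      then show "x \<in> \<Union>{A \<in> \<A> n. \<exists>b\<in>A. P b}" using obtain_atom[OF n, of x] by blast
    next
      fix x assume "x \<in> \<Union>{A \<in> \<A> n. \<exists>b\<in>A. P b}"
      then obtain A b where "A \<in> \<A> n" "b \<in> A" "P b" "x \<in> A" by blast
      moreover from this have "x \<in> B n" using partition_onD1[OF partition_\<A>[OF n]] by blast
      ultimately show "x \<in> {b \<in> B n. P b}" using that by blast
    qed
    moreover have "\<dots> \<in> sets M"
      using countable_\<A>[OF n] \<A>_sets[OF n] by (intro sets.countable_Union) auto
    ultimately show ?thesis by simp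
  qed
  have Q_sets: "{b \<in> B n. Q t b} \<in> sets M" "{b \<in> B n. \<not> Q t b} \<in> sets M" if "t \<in> T n" for t
    by (rule base, use const that in blast)+
  show sets: "cells n Q \<in> sets M"
    unfolding cells_def using finite_T[OF n] Q_sets by (intro sets.finite_UN pmp_image_sets[OF S]) auto
  assume k: "\<And>b. b \<in> B n \<Longrightarrow> real (card {t \<in> T n. \<not> Q t b}) \<le> k"
  define U where "U = (\<Union>t\<in>T n. S t ` {b \<in> B n. \<not> Q t b})"
  have U: "U \<in> sets M"
    unfolding U_def using finite_T[OF n] Q_sets by (intro sets.finite_UN pmp_image_sets[OF S]) auto
  have "real (card (T n)) * prob (B n) = (\<Sum>t\<in>T n. prob (S t ` B n))"
    using pmp_measure_image[OF S B_sets[OF n]] by simp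
  also have "\<dots> = prob (\<Union>t\<in>T n. S t ` B n)"
    using eps_tower[OF n] pmp_image_sets[OF S B_sets[OF n]]
    by (intro finite_measure_finite_Union[symmetric]) (auto simp: is_eps_tower_def is_tower_def)
  also have "\<dots> \<le> 1" by (rule prob_le_1)
  finally have prob_B: "prob (B n) \<le> 1 / real (card (T n))"
    using card_T_pos[OF n] by (simp add: field_simps)
  have "prob U \<le> (\<Sum>t\<in>T n. prob (S t ` {b \<in> B n. \<not> Q t b}))"
    unfolding U_def using finite_T[OF n] Q_sets
    by (intro finite_measure_subadditive_finite) (auto intro: pmp_image_sets[OF S])
  also have "\<dots> = (\<Sum>t\<in>T n. prob {b \<in> B n. \<not> Q t b})"
    using Q_sets by (intro sum.cong pmp_measure_image[OF S]) auto
  \<comment> \<open>Measures become integrals of indicators, so that the sum over levels turns into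
    the integral of the number of bad levels above \<open>b\<close>.\<close>
  also have "\<dots> = (\<Sum>t\<in>T n. LINT b|M. indicator {b \<in> B n. \<not> Q t b} b)"
    using Q_sets by (intro sum.cong) (auto simp: Int_absorb2 sets.sets_into_space)
  also have "\<dots> = (LINT b|M. (\<Sum>t\<in>T n. indicator {b \<in> B n. \<not> Q t b} b))"
    using Q_sets by (intro Bochner_Integration.integral_sum[symmetric]) (auto simp: less_top[symmetric])
  also have "\<dots> \<le> (LINT b|M. k * indicator (B n) b)"
  proof (rule integral_mono)
    show "integrable M (\<lambda>b. \<Sum>t\<in>T n. indicator {b \<in> B n. \<not> Q t b} b :: real)"
      using Q_sets by (intro Bochner_Integration.integrable_sum) (auto simp: less_top[symmetric])
    show "integrable M (\<lambda>b. k * indicator (B n) b)"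
      using B_sets[OF n] by (intro integrable_mult_right) (auto simp: less_top[symmetric])
    fix b
    have "(\<Sum>t\<in>T n. indicator {b \<in> B n. \<not> Q t b} b) = real (card {t \<in> T n. \<not> Q t b})" if "b \<in> B n"
      using that finite_T[OF n] by (simp add: indicator_def sum.If_cases Int_def)
    then show "(\<Sum>t\<in>T n. indicator {b \<in> B n. \<not> Q t b} b) \<le> k * indicator (B n) b"
      using k by (cases "b \<in> B n") (auto intro: sum_nonpos)
  qed
  also have "\<dots> = k * prob (B n)"
    using B_sets[OF n] by (simp add: Int_absorb2 sets.sets_into_space)
  finally have prob_U: "prob U \<le> k * prob (B n)" .
  have "prob U \<le> k / card (T n)"
  \<comment> \<open>Over an empty base the hypothesis on \<open>k\<close> is vacuous and leaves its
    sign open; but an empty tower misses measure 1, against \<epsilon> n < 1.\<close>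
  proof (cases "B n = {}")
    case False
    then have "k \<ge> 0" using k of_nat_0_le_iff order_trans by blast
    then have "k * prob (B n) \<le> k * (1 / card (T n))" using prob_B by (intro mult_left_mono)
    with prob_U show ?thesis by simp
  next
    case True
    have "tower_union S (T n) (B n) = {}" using True by (simp add: tower_union_def)
    then have "prob (space M) < \<epsilon> n" using eps_tower[OF n] by (simp add: is_eps_tower_def)
    moreover have "1 / 2 ^ n \<le> (1 :: real)" by simp
    ultimately have False using \<epsilon>_less[OF n] prob_space by linarith
    then show ?thesis ..
  qed
  moreover have "prob (space M - tower_union S (T n) (B n)) \<le> 1 / 2 ^ n"
    using eps_tower[OF n] \<epsilon>_less[OF n] by (simp add: is_eps_tower_def)
  moreover have "prob (space M - cells n Q) \<le> prob (space M - tower_union S (T n) (B n)) + prob U"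
  proof -
    have tu: "tower_union S (T n) (B n) \<in> sets M"
      unfolding tower_union_def using finite_T[OF n] B_sets[OF n]
      by (intro sets.finite_UN pmp_image_sets[OF S]) auto
    have "space M - cells n Q \<subseteq> (space M - tower_union S (T n) (B n)) \<union> U"
      by (auto simp: cells_def tower_union_def U_def)
    then have "prob (space M - cells n Q) \<le> prob ((space M - tower_union S (T n) (B n)) \<union> U)"
      using tu U by (intro finite_measure_mono) auto
    also have "\<dots> \<le> prob (space M - tower_union S (T n) (B n)) + prob U"
      using tu U by (intro measure_Un_le) auto
    finally show ?thesis .
  qed
  ultimately show "prob (space M - cells n Q) \<le> 1 / 2 ^ n + k / card (T n)" by linarith
qed

section \<open>Stabilisation of the labels\<close>

abbreviation shift :: "nat \<Rightarrow> int \<times> int \<Rightarrow> 'a \<Rightarrow> 'a \<Rightarrow> bool" where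
  "shift n \<equiv> tile_shift S (T n) (B n) (\<alpha> n)"

lemma shift_sym: "shift n g x y \<Longrightarrow> shift n (- g) y x"
  unfolding tile_shift_def by (metis minus_diff_eq)

text \<open>Both shifts take place in the same column, because \<open>y\<close> has only one pair of
  coordinates, and label differences add.\<close>

lemma shift_trans:
  assumes n: "n \<ge> 1" and "shift n g x y" "shift n h y z"
  shows "shift n (h + g) x z"
proof -
  obtain t t' b where 1: "t \<in> T n" "t' \<in> T n" "b \<in> B n" "x = S t b" "y = S t' b"
      "\<alpha> n t' b - \<alpha> n t b = g"
    using assms(2) by (auto simp: tile_shift_def)
  obtain u u' c where 2: "u \<in> T n" "u' \<in> T n" "c \<in> B n" "y = S u c" "z = S u' c"
      "\<alpha> n u' c - \<alpha> n u c = h"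
    using assms(3) by (auto simp: tile_shift_def)
  have "u = t'" "c = b"
    using column_unique[OF n 2(3) 1(3) 2(1) 1(2)] 1(5) 2(4) by auto
  then have "\<alpha> n u' b - \<alpha> n t b = h + g" using 1(6) 2(6) by auto
  then show ?thesis
    unfolding tile_shift_def using 1 2 \<open>c = b\<close> by blast
qed

lemma shift_same_target:
  assumes n: "n \<ge> 1" and "shift n g x y" "shift n h x y"
  shows "g = h"
proof -
  obtain t t' b where 1: "t \<in> T n" "t' \<in> T n" "b \<in> B n" "x = S t b" "y = S t' b"
      "\<alpha> n t' b - \<alpha> n t b = g"
    using assms(2) by (auto simp: tile_shift_def)
  obtain u u' c where 2: "u \<in> T n" "u' \<in> T n" "c \<in> B n" "x = S u c" "y = S u' c"
      "\<alpha> n u' c - \<alpha> n u c = h"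
    using assms(3) by (auto simp: tile_shift_def)
  have "u = t" "c = b"
    using column_unique[OF n 2(3) 1(3) 2(1) 1(1)] 1(4) 2(4) by auto
  moreover have "u' = t'"
    using column_unique[OF n 2(3) 1(3) 2(2) 1(2)] 1(5) 2(5) by auto
  ultimately show ?thesis using 1(6) 2(6) by simp
qed

text \<open>The labels are injective on a column, so the label of the target determines its
  level.\<close>

lemma shift_same_label:
  assumes n: "n \<ge> 1" and "shift n g x y" "shift n g x z"
  shows "y = z"
proof -
  obtain t t' b where 1: "t \<in> T n" "t' \<in> T n" "b \<in> B n" "x = S t b" "y = S t' b"
      "\<alpha> n t' b - \<alpha> n t b = g"
    using assms(2) by (auto simp: tile_shift_def)
  obtain u u' c where 2: "u \<in> T n" "u' \<in> T n" "c \<in> B n" "x = S u c" "z = S u' c"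
      "\<alpha> n u' c - \<alpha> n u c = g"
    using assms(3) by (auto simp: tile_shift_def)
  have eq: "u = t" "c = b"
    using column_unique[OF n 2(3) 1(3) 2(1) 1(1)] 1(4) 2(4) by auto
  then have "\<alpha> n t' b - \<alpha> n t b = \<alpha> n u' b - \<alpha> n t b" using 1(6) 2(6) by simp
  then have "\<alpha> n t' b = \<alpha> n u' b" by simp
  then have "t' = u'"
    using \<alpha>_bij[OF n 1(3)] 1(2) 2(2) by (auto simp: bij_betw_def dest: inj_onD)
  then show ?thesis using 1(5) 2(5) eq by simp
qed

lemma shift_orbit:
  assumes "n \<ge> 1" and "shift n g x y"
  shows "\<exists>k. y = S k x"
proof -
  obtain t t' b where "b \<in> B n" "x = S t b" "y = S t' b"
    using assms(2) by (auto simp: tile_shift_def)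
  moreover from this have "b \<in> space M" using B_space[OF assms(1)] by simp
  ultimately have "y = S (t' - t) x"
    by (simp add: pmp_add[OF S, symmetric])
  then show ?thesis ..
qed

text \<open>The points whose column of the \<open>n\<close>-th tower is a complete segment of a column of the next
  tower, so that condition (f) applies to it.\<close>

definition deep :: "nat \<Rightarrow> 'a set" where
  "deep n = cells n (\<lambda>_ _. True) \<inter>
     cells (n + 1) (\<lambda>t _. int (card (T n)) \<le> t \<and> t + int (card (T n)) \<le> int (card (T (n + 1))))"

text \<open>The column of \<open>x\<close> is a complete segment of a column of the next tower, and
  along it the labels of the two stages differ by one translation, which cancels in
  differences.\<close>

lemma shift_step:
  assumes n: "n \<ge> 1" and x: "x \<in> deep n" and "shift n g x y"
  shows "shift (n + 1) g x y"
proof -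
  obtain t t' b where 1: "t \<in> T n" "t' \<in> T n" "b \<in> B n" "x = S t b" "y = S t' b"
      "\<alpha> n t' b - \<alpha> n t b = g"
    using assms(3) by (auto simp: tile_shift_def)
  obtain u c where 2: "u \<in> T (n + 1)" "c \<in> B (n + 1)" "x = S u c"
      "int (card (T n)) \<le> u" "u + int (card (T n)) \<le> int (card (T (n + 1)))"
    using x unfolding deep_def by (blast elim: cellsE)
  have c: "c \<in> space M" and b: "b \<in> space M"
    using B_space 1(3) 2(2) n by auto
  \<comment> \<open>Start of the short column inside the long one. The margins in
    \<open>deep\<close> give i \<ge> 0 and room for all of \<open>T n\<close> above it.\<close>
  define i where "i = u - t"
  have "S i c = S (- t) (S u c)" using c by (simp add: i_def pmp_add[OF S, symmetric])
  also have "\<dots> = b" using 1(4) 2(3) pmp_inverse(1)[OF S b, of t] by simp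
  finally have i: "S i c = b" .
  have t: "0 \<le> t" "t < int (card (T n))" "0 \<le> t'" "t' < int (card (T n))"
    using 1 n by (simp_all add: T_mem)
  obtain d where d: "\<And>j. j \<in> T n \<Longrightarrow> \<alpha> (n + 1) (i + j) c = \<alpha> n j (S i c) + d"
    using refinement[OF n 2(2), of i] 1(3) 2(4,5) t i by (auto simp: i_def)
  have "\<alpha> (n + 1) (i + t') c - \<alpha> (n + 1) (i + t) c = g"
    using d[OF 1(1)] d[OF 1(2)] i 1(6) by simp
  moreover have "i + t \<in> T (n + 1)" "i + t' \<in> T (n + 1)"
    using t 2(4,5) by (auto simp: i_def T_mem)
  moreover have "x = S (i + t) c" using 2(3) by (simp add: i_def)
  moreover have "y = S (i + t') c"
    using 1(5) i c by (metis add.commute pmp_add[OF S])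
  ultimately show ?thesis unfolding tile_shift_def using 2(2) by blast
qed

text \<open>Deep at every stage from \<open>n\<close> on, so that label differences seen at stage
  \<open>n\<close> are final.\<close>

definition settled :: "nat \<Rightarrow> 'a set" where
  "settled n = (\<Inter>m\<in>{n..}. deep m)"

lemma shift_settled:
  assumes n: "n \<ge> 1" and x: "x \<in> settled n" and sh: "shift n g x y" and "n \<le> m"
  shows "shift m g x y"
  using \<open>n \<le> m\<close>
proof (induction m rule: dec_induct)
  case (step m)
  then have "x \<in> deep m" using x by (auto simp: settled_def)
  then show ?case using shift_step[of m] step n by simp
qed (rule sh)

lemma deep_sets: "n \<ge> 1 \<Longrightarrow> deep n \<in> sets M"
  unfolding deep_def by (intro sets.Int cells_sets) auto

lemma settled_sets: "n \<ge> 1 \<Longrightarrow> settled n \<in> sets M"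
  unfolding settled_def by (intro sets.countable_INT') (auto intro: deep_sets)

text \<open>Three losses: missing the n-th tower, missing the next one, and lying in one of at most
  2 |T n| levels near its ends, whose proportion is controlled by (b).\<close>

lemma prob_not_deep:
  assumes n: "n \<ge> 1"
  shows "prob (space M - deep n) \<le> 4 / 2 ^ n"
proof -
  define X where "X = cells n (\<lambda>_ _. True)"
  define Q where "Q t (b :: 'a) \<longleftrightarrow>
    int (card (T n)) \<le> t \<and> t + int (card (T n)) \<le> int (card (T (n + 1)))" for t b
  define Y where "Y = cells (n + 1) Q"
  have sets: "X \<in> sets M" "Y \<in> sets M"
    using n unfolding X_def Y_def by (auto intro!: cells_sets simp: Q_def)
  have "prob (space M - X) \<le> 1 / 2 ^ n + 0 / card (T n)"
    unfolding X_def using n by (intro prob_not_cells) auto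
  moreover have "prob (space M - Y) \<le> 1 / 2 ^ (n + 1) + real (2 * card (T n)) / card (T (n + 1))"
    unfolding Y_def
  proof (intro prob_not_cells)
    fix b
    have "{t \<in> T (n + 1). \<not> Q t b} \<subseteq> {0..<int (card (T n))} \<union>
        {int (card (T (n + 1))) - int (card (T n))<..<int (card (T (n + 1)))}"
      using n by (auto simp: T_mem Q_def)
    then have "card {t \<in> T (n + 1). \<not> Q t b} \<le> card ({0..<int (card (T n))} \<union>
        {int (card (T (n + 1))) - int (card (T n))<..<int (card (T (n + 1)))})"
      by (intro card_mono) auto
    also have "\<dots> \<le> 2 * card (T n)" by (rule order_trans[OF card_Un_le]) auto
    finally show "real (card {t \<in> T (n + 1). \<not> Q t b}) \<le> real (2 * card (T n))"
      by (rule of_nat_mono)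
  qed (auto simp: Q_def)
  moreover have "real (2 * card (T n)) / card (T (n + 1)) \<le> 2 * (1 / 2 ^ (n + 1))"
    using card_T_ratio[OF n] \<epsilon>_less[of "n + 1"] by simp
  moreover have "prob (space M - deep n) \<le> prob (space M - X) + prob (space M - Y)"
  proof -
    have "space M - deep n = (space M - X) \<union> (space M - Y)"
      by (auto simp: deep_def X_def Y_def Q_def[abs_def])
    then show ?thesis using sets by (auto intro!: measure_Un_le)
  qed
  ultimately have "prob (space M - deep n) \<le> 1 / 2 ^ n + 3 * (1 / 2 ^ (n + 1))" by simp
  also have "\<dots> \<le> 4 / 2 ^ n" by (simp add: field_simps)
  finally show ?thesis .
qed

text \<open>Union bound over all later stages; the bounds 4 / 2^m for m \<ge> n form a geometric
  series with sum 8 / 2^n.\<close>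

lemma prob_not_settled:
  assumes n: "n \<ge> 1"
  shows "prob (space M - settled n) \<le> 8 / 2 ^ n"
proof -
  have sums: "(\<lambda>i. 4 / 2 ^ (n + i)) sums (8 / 2 ^ n :: real)"
    using sums_mult[OF geometric_sums[of "1 / 2 :: real"], of "4 / 2 ^ n"]
    by (simp add: power_add power_divide)
  have summable: "summable (\<lambda>i. prob (space M - deep (n + i)))"
    by (rule summable_comparison_test'[OF sums_summable[OF sums]])
      (use prob_not_deep n in \<open>simp add: measure_nonneg\<close>)
  have "space M - settled n = (\<Union>i. space M - deep (n + i))"
    by (auto simp: settled_def nat_le_iff_add)
  moreover have "range (\<lambda>i. space M - deep (n + i)) \<subseteq> sets M"
    using deep_sets n by auto
  ultimately have "prob (space M - settled n) \<le> (\<Sum>i. prob (space M - deep (n + i)))"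
    using finite_measure_subadditive_countably[OF _ summable] by simp
  also have "\<dots> \<le> (\<Sum>i. 4 / 2 ^ (n + i))"
    using n by (intro suminf_le summable sums_summable[OF sums] prob_not_deep) auto
  also have "\<dots> = 8 / 2 ^ n" by (rule sums_unique[OF sums, symmetric])
  finally show ?thesis .
qed

text \<open>Common estimate for both actions. A boundary of size K sqrt |T n| has proportion K /
  sqrt |T n| \<le> 2 K / 2^n in a column; the 9 collects 8 for unsettled points and 1 for points
  outside the tower.\<close>

lemma prob_not_settled_cells:
  assumes n: "n \<ge> 1" and "0 \<le> K"
    and const: "\<And>A b b' t. A \<in> \<A> n \<Longrightarrow> b \<in> A \<Longrightarrow> b' \<in> A \<Longrightarrow> t \<in> T n \<Longrightarrow> Q t b = Q t b'"
    and K: "\<And>b. b \<in> B n \<Longrightarrow> real (card {t \<in> T n. \<not> Q t b}) \<le> K * sqrt (card (T n))"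
  shows "prob (space M - (settled n \<inter> cells n Q)) \<le> (9 + 2 * K) / 2 ^ n"
proof -
  have cells: "cells n Q \<in> sets M" using const by (intro cells_sets n)
  have "space M - (settled n \<inter> cells n Q) = (space M - settled n) \<union> (space M - cells n Q)" by auto
  then have "prob (space M - (settled n \<inter> cells n Q)) \<le>
      prob (space M - settled n) + prob (space M - cells n Q)"
    using settled_sets[OF n] cells by (auto intro!: measure_Un_le)
  also have "\<dots> \<le> 8 / 2 ^ n + (1 / 2 ^ n + K * sqrt (card (T n)) / card (T n))"
    using const K by (intro add_mono prob_not_settled prob_not_cells n)
  also have "K * sqrt (card (T n)) / card (T n) \<le> 2 * K / 2 ^ n"
  proof -
    have "(2 ^ n)\<^sup>2 = (4 :: real) ^ n"
      by (simp add: power2_eq_square power_mult_distrib[symmetric])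
    then have "sqrt ((2 ^ n)\<^sup>2) \<le> sqrt (2\<^sup>2 * real (card (T n)))"
      using card_T_ge[OF n] by (intro real_sqrt_le_mono) simp
    then have le: "2 ^ n \<le> 2 * sqrt (real (card (T n)))" by (simp add: real_sqrt_mult)
    have pos: "sqrt (real (card (T n))) > 0" using card_T_pos[OF n] by simp
    have "K * sqrt (card (T n)) / card (T n) = K / sqrt (card (T n))"
      using pos by (simp add: field_simps)
    also have "\<dots> \<le> K * (2 / 2 ^ n)"
    proof -
      have "1 / sqrt (card (T n)) \<le> 2 / 2 ^ n" using le pos by (simp add: field_simps)
      from mult_left_mono[OF this \<open>0 \<le> K\<close>] show ?thesis by simp
    qed
    finally show ?thesis by (simp add: mult.commute)
  qed
  also have "8 / 2 ^ n + (1 / 2 ^ n + 2 * K / 2 ^ n) = (9 + 2 * K) / 2 ^ n"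
    by (simp add: add_divide_distrib)
  finally show ?thesis by simp
qed

section \<open>Points that stay in their column or tile\<close>

text \<open>Here x and \<open>S k x\<close> lie in one column and their label difference is final,
  so up to a null set it is the value of the cocycle at \<open>k\<close>.\<close>

definition stay_S :: "int \<Rightarrow> nat \<Rightarrow> 'a set" where
  "stay_S k n = settled n \<inter> cells n (\<lambda>t _. t + k \<in> T n)"

text \<open>Counterpart for the other action: the tile contains the label moved by \<open>g\<close>,
  so some level of the same column carries it.\<close>

definition stay_R :: "int \<times> int \<Rightarrow> nat \<Rightarrow> 'a set" where
  "stay_R g n = settled n \<inter> cells n (\<lambda>t b. \<alpha> n t b + g \<in> F n)"

lemma stay_S_sets: "n \<ge> 1 \<Longrightarrow> stay_S k n \<in> sets M"
  unfolding stay_S_def by (intro sets.Int settled_sets cells_sets) auto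

lemma prob_not_stay_S:
  assumes n: "n \<ge> 1"
  shows "prob (space M - stay_S k n) \<le> (9 + 2 * \<bar>real_of_int k\<bar>) / 2 ^ n"
  unfolding stay_S_def
proof (rule prob_not_settled_cells[OF n])
  fix b
  have "{t \<in> T n. t + k \<notin> T n} =
      {t \<in> {0..int (card (T n)) - 1}. t + k \<notin> {0..int (card (T n)) - 1}}"
    using n by (auto simp: T_mem)
  then have "card {t \<in> T n. t + k \<notin> T n} \<le> nat \<bar>k\<bar>"
    by (simp only: card_shift_out_le)
  \<comment> \<open>The factor 1 is then replaced by sqrt |T n| \<ge> 1, which brings the bounded
    boundary of an interval to the common form.\<close>
  then have "real (card {t \<in> T n. t + k \<notin> T n}) \<le> \<bar>real_of_int k\<bar> * 1" by linarith
  also have "\<dots> \<le> \<bar>real_of_int k\<bar> * sqrt (card (T n))"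
    using card_T_pos[OF n] by (intro mult_left_mono) auto
  finally show "real (card {t \<in> T n. t + k \<notin> T n}) \<le> \<bar>real_of_int k\<bar> * sqrt (card (T n))" .
qed auto

lemma stay_R_const:
  assumes "n \<ge> 1" "A \<in> \<A> n" "b \<in> A" "b' \<in> A" "t \<in> T n"
  shows "(\<alpha> n t b + g \<in> F n) = (\<alpha> n t b' + g \<in> F n)"
  using \<alpha>_const[OF assms] by simp

lemma stay_R_sets:
  assumes n: "n \<ge> 1"
  shows "stay_R g n \<in> sets M"
  unfolding stay_R_def
  by (intro sets.Int settled_sets[OF n] cells_sets[OF n]) (rule stay_R_const[OF n])

text \<open>The labels of a column run through the square exactly once, so the bad positions are
  counted by the boundary points of the square.\<close>

lemma prob_not_stay_R:
  assumes n: "n \<ge> 1"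
  shows "prob (space M - stay_R g n) \<le> (9 + 2 * real (nat (\<bar>fst g\<bar> + \<bar>snd g\<bar>))) / 2 ^ n"
  unfolding stay_R_def
proof (rule prob_not_settled_cells[OF n])
  show "(\<alpha> n t b + g \<in> F n) = (\<alpha> n t b' + g \<in> F n)"
    if "A \<in> \<A> n" "b \<in> A" "b' \<in> A" "t \<in> T n" for A b b' t
    by (rule stay_R_const[OF n that])
  fix b assume b: "b \<in> B n"
  have img: "(\<lambda>t. \<alpha> n t b) ` {t \<in> T n. \<alpha> n t b + g \<notin> F n} = {f \<in> F n. f + g \<notin> F n}"
    unfolding bij_betw_imp_surj_on[OF \<alpha>_bij[OF n b], symmetric] by blast
  have "inj_on (\<lambda>t. \<alpha> n t b) {t \<in> T n. \<alpha> n t b + g \<notin> F n}"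
    using bij_betw_imp_inj_on[OF \<alpha>_bij[OF n b]] by (rule inj_on_subset) auto
  from card_image[OF this]
  have "card {t \<in> T n. \<alpha> n t b + g \<notin> F n} = card {f \<in> F n. f + g \<notin> F n}"
    by (simp only: img)
  then show "real (card {t \<in> T n. \<alpha> n t b + g \<notin> F n}) \<le>
      real (nat (\<bar>fst g\<bar> + \<bar>snd g\<bar>)) * sqrt (card (T n))"
    using card_square_shift_out_le[OF F_square[OF n], of g] card_F[OF n] by simp
qed auto

text \<open>The points in no \<open>X n\<close> form a set of measure at most Q / 2^n for every n
  \<ge> 1.\<close>

lemma AE_ex_level:
  assumes X: "\<And>n. n \<ge> 1 \<Longrightarrow> X n \<in> sets M" and Q: "\<And>n. n \<ge> 1 \<Longrightarrow> prob (space M - X n) \<le> Q / 2 ^ n"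
  shows "AE x in M. \<exists>n\<ge>1. x \<in> X n"
proof -
  define N where "N = (\<Inter>n\<in>{1..}. space M - X n)"
  have N: "N \<in> sets M" unfolding N_def using X by (intro sets.countable_INT') auto
  have "prob N = 0"
  proof (rule le_div_power2_imp_0)
    fix n :: nat assume n: "n > 0"
    have "prob N \<le> prob (space M - X n)"
      using X n by (intro finite_measure_mono) (auto simp: N_def)
    also have "\<dots> \<le> Q / 2 ^ n" using Q n by simp
    finally show "prob N \<le> Q / 2 ^ n" .
  qed simp
  then have "AE x in M. x \<notin> N" using N by (simp add: prob_eq_0)
  then show ?thesis
  proof (rule AE_mp)
    show "AE x in M. x \<notin> N \<longrightarrow> (\<exists>n\<ge>1. x \<in> X n)" by (rule AE_I2) (auto simp: N_def)
  qed
qed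

lemma AE_stay_S: "AE x in M. \<forall>k. \<exists>n\<ge>1. x \<in> stay_S k n"
  unfolding AE_all_countable using AE_ex_level[OF stay_S_sets prob_not_stay_S] by blast

text \<open>For almost every x, the points x and \<open>S k x\<close> lie in one column of some
  tower, at levels t and t + k, which are disjoint for k \<noteq> 0.\<close>

lemma free_S: "free_action M S"
  unfolding free_action_def using AE_stay_S
proof (rule AE_mp, intro AE_I2 impI allI)
  fix x and k :: int
  assume x: "\<forall>k. \<exists>n\<ge>1. x \<in> stay_S k n" and k: "k \<noteq> 0"
  then obtain n where n: "n \<ge> 1" "x \<in> stay_S k n" by blast
  then obtain t b where t: "t \<in> T n" "b \<in> B n" "x = S t b" "t + k \<in> T n"
    unfolding stay_S_def by (auto elim: cellsE)
  have "S k x = S (t + k) b"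
    using t(3) B_space[OF n(1) t(2)] by (simp add: pmp_add[OF S, symmetric] add.commute)
  then show "S k x \<noteq> x" using column_unique(1)[OF n(1) t(2,2) t(4,1)] t(3) k by auto
qed

text \<open>There are at most |T n|^2 differences of elements of \<open>D n\<close>, hence at most
  2^(2 n^3) for large n, and the entropy criterion applies with c n = 2 n^3. \<open>D n\<close> will
  be the tile for one cocycle and the set of levels for the other.\<close>

lemma entropy_finite:
  fixes f :: "'a \<Rightarrow> 'h::group_add" and D :: "nat \<Rightarrow> 'h set"
  assumes f: "f \<in> measurable M (count_space UNIV)"
    and D: "\<And>n. n \<ge> 1 \<Longrightarrow> finite (D n)" "\<And>n. n \<ge> 1 \<Longrightarrow> card (D n) = card (T n)"
    and Q: "\<And>n. n \<ge> 1 \<Longrightarrow> prob {x \<in> space M. f x \<notin> (\<lambda>(d, e). d - e) ` (D n \<times> D n)} \<le> Q / 2 ^ n"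
  shows "partition_entropy M f < \<infinity>"
proof -
  obtain N where N: "\<And>n. n > N \<Longrightarrow> card (T n) < 2 ^ (n ^ 3)" using card_T_bound by blast
  \<comment> \<open>The height bound holds only beyond \<open>N\<close>. Earlier sets are left
    empty, and the constant 2^N makes their probability bound trivial.\<close>
  define V where "V n = (if n > N then (\<lambda>(d, e). d - e) ` (D n \<times> D n) else {})" for n
  show ?thesis
  proof (rule partition_entropy_finite[OF f, where V = V])
    show "finite (V n)" for n using D(1) by (simp add: V_def)
    show "card (V n) \<le> 2 ^ (2 * n ^ 3)" for n
    proof (cases "n > N")
      case True
      have "card (V n) \<le> card (D n \<times> D n)"
        unfolding V_def using True D(1)[of n] by (simp only: if_True) (rule card_image_le, simp)
      also have "\<dots> = card (T n) * card (T n)"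
        using True D(2) by (simp add: card_cartesian_product)
      also have "\<dots> \<le> 2 ^ (n ^ 3) * 2 ^ (n ^ 3)"
        using N[OF True] by (intro mult_mono) auto
      also have "\<dots> = 2 ^ (2 * n ^ 3)" by (simp add: power_add[symmetric] mult_2)
      finally show ?thesis .
    qed (simp add: V_def)
    show "summable (\<lambda>n. real (2 * n ^ 3) / 2 ^ n)"
    proof (rule summable_comparison_test_bigo)
      show "summable (\<lambda>n. norm (inverse (real n ^ 2)))"
        using inverse_power_summable[of 2, where ?'a = real] by simp
      show "(\<lambda>n. real (2 * n ^ 3) / 2 ^ n) \<in> O(\<lambda>n. inverse (real n ^ 2))"
        by real_asymp
    qed
    show "prob {x \<in> space M. f x \<notin> V n} \<le> max Q (2 ^ N) / 2 ^ n" for n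
    proof (cases "n > N")
      case True
      then have "prob {x \<in> space M. f x \<notin> V n} \<le> Q / 2 ^ n" using Q by (simp add: V_def)
      also have "\<dots> \<le> max Q (2 ^ N) / 2 ^ n" by (intro divide_right_mono) auto
      finally show ?thesis .
    next
      case False
      then have "(2 :: real) ^ n \<le> 2 ^ N" by (intro power_increasing) auto
      then have "1 \<le> max Q (2 ^ N) / 2 ^ n" by (simp add: field_simps le_max_iff_disj)
      then show ?thesis using order_trans[OF prob_le_1] by blast
    qed
  qed
qed

end

section \<open>The induced action and its cocycles\<close>

locale tower_induced = tower_tiling M S \<epsilon> T B F \<alpha> \<A> C
  for M :: "'a measure" and S \<epsilon> T B F \<alpha> \<A> C +
  fixes R :: "int \<times> int \<Rightarrow> 'a \<Rightarrow> 'a"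
  assumes induced: "induced_action M S T B \<alpha> R"
begin

lemma R: "pmp_action M R"
  using induced by (simp add: induced_action_def)

text \<open>The induced action is prescribed on the two generators. The property passes to sums and
  inverses, hence to the whole countable group.\<close>

lemma AE_shift: "AE x in M. \<forall>g. \<forall>\<^sub>F n in sequentially. shift n g x (R g x)"
proof -
  let ?P = "\<lambda>g. AE x in M. \<forall>\<^sub>F n in sequentially. shift n g x (R g x)"
  have gen: "?P (1, 0)" "?P (0, 1)" using induced by (auto simp: induced_action_def)
  \<comment> \<open>The shift by \<open>g\<close> is needed at \<open>R h x\<close>, where it holds
    almost surely by invariance of the measure; at large stages the two shifts compose.\<close>
  have add: "?P (g + h)" if g: "?P g" and h: "?P h" for g h
    using pmp_AE[OF R g, of h] h
    AE_space
  proof eventually_elim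
    case (elim x)
    then have "\<forall>\<^sub>F n in sequentially. n \<ge> 1 \<and> shift n g (R h x) (R g (R h x)) \<and> shift n h x (R h x)"
      using eventually_ge_at_top by (intro eventually_conj) auto
    then show ?case
      unfolding pmp_add[OF R elim(3)] by (rule eventually_mono) (metis shift_trans)
  qed
  \<comment> \<open>The shift by \<open>g\<close> starting at \<open>R (- g) x\<close> ends at x; it
    is reversed.\<close>
  have minus: "?P (- g)" if g: "?P g" for g
    using pmp_AE[OF R g, of "- g"] AE_space
  proof eventually_elim
    case (elim x)
    then show ?case
      by (auto simp: pmp_inverse[OF R] elim!: eventually_mono dest: shift_sym)
  qed
  have zero: "?P 0" using add[OF gen(1) minus[OF gen(1)]] by (simp only: add.right_inverse)
  have mult: "?P (int n * fst g, int n * snd g)" if g: "?P g" for n g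
  proof (induction n)
    case 0
    show ?case using zero by (simp add: zero_prod_def)
  next
    case (Suc n)
    have "(int (Suc n) * fst g, int (Suc n) * snd g) = g + (int n * fst g, int n * snd g)"
      by (cases g) (simp add: algebra_simps)
    then show ?case using add[OF g Suc] by (simp only:)
  qed
  have axis: "?P (a * fst g, a * snd g)" if g: "?P g" for a g
    using mult[OF g, of "nat a"] minus[OF mult[OF g, of "nat (- a)"]]
    by (cases "a \<ge> 0") auto
  have "?P g" for g
    using add[OF axis[OF gen(1), of "fst g"] axis[OF gen(2), of "snd g"]] by simp
  then show ?thesis by (simp add: AE_all_countable)
qed

text \<open>At a common later stage both \<open>y\<close> and \<open>R g x\<close> are reached from
  x with label difference \<open>g\<close>, and such a point is unique.\<close>

lemma settled_R:
  assumes x: "\<forall>g. \<forall>\<^sub>F n in sequentially. shift n g x (R g x)"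
    and n: "n \<ge> 1" "x \<in> settled n" "shift n g x y"
  shows "R g x = y"
proof -
  obtain N where N: "\<And>m. m \<ge> N \<Longrightarrow> shift m g x (R g x)"
    using x unfolding eventually_sequentially by blast
  have "shift (max n N) g x (R g x)" "shift (max n N) g x y"
    using N shift_settled[OF n] by auto
  then show ?thesis using shift_same_label[of "max n N" g x] n(1) by simp
qed

text \<open>A fixed point of \<open>R g\<close> would be shifted to itself by \<open>g\<close> and,
  after composing with the reverse shift, also by 0, but two points of a column have only one label
  difference.\<close>

lemma free_R: "free_action M R"
  unfolding free_action_def using AE_shift
proof (rule AE_mp, intro AE_I2 impI allI notI)
  fix x and g :: "int \<times> int"
  assume x: "\<forall>g. \<forall>\<^sub>F n in sequentially. shift n g x (R g x)" and g: "g \<noteq> 0" and eq: "R g x = x"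
  have "\<forall>\<^sub>F n in sequentially. n \<ge> 1 \<and> shift n g x (R g x)"
    by (intro eventually_conj eventually_ge_at_top x[rule_format])
  then obtain n where n: "n \<ge> 1" "shift n g x x"
    using eq by (auto dest: eventually_happens)
  have "shift n (- g) x x" using shift_sym[OF n(2)] .
  then have "shift n 0 x x" using shift_trans[OF n(1) n(2)] by fastforce
  then show False using shift_same_target[OF n] g by blast
qed

text \<open>The witness is the label difference between levels t and t + k of the column, which is
  final because x is settled.\<close>

lemma R_eq_S:
  assumes x: "\<forall>g. \<forall>\<^sub>F n in sequentially. shift n g x (R g x)"
    and n: "n \<ge> 1" "x \<in> stay_S k n"
  shows "\<exists>h \<in> (\<lambda>(d, e). d - e) ` (F n \<times> F n). R h x = S k x"
proof -
  obtain t b where t: "t \<in> T n" "b \<in> B n" "x = S t b" "t + k \<in> T n"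
    using n(2) unfolding stay_S_def by (auto elim: cellsE)
  have y: "S k x = S (t + k) b"
    using t(3) B_space[OF n(1) t(2)] by (simp add: pmp_add[OF S, symmetric] add.commute)
  define h where "h = \<alpha> n (t + k) b - \<alpha> n t b"
  have "shift n h x (S k x)"
    unfolding tile_shift_def h_def using t y by blast
  moreover have "x \<in> settled n" using n(2) by (simp add: stay_S_def)
  ultimately have "R h x = S k x" by (intro settled_R[OF x n(1)])
  moreover have "h \<in> (\<lambda>(d, e). d - e) ` (F n \<times> F n)"
    using bij_betwE[OF \<alpha>_bij[OF n(1) t(2)]] t by (auto simp: h_def)
  ultimately show ?thesis by blast
qed

text \<open>The witness is t' - t, where t' is the level of the column that carries the label of x
  moved by \<open>g\<close>.\<close>

lemma S_eq_R:
  assumes x: "\<forall>g. \<forall>\<^sub>F n in sequentially. shift n g x (R g x)"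
    and n: "n \<ge> 1" "x \<in> stay_R g n"
  shows "\<exists>k \<in> (\<lambda>(d, e). d - e) ` (T n \<times> T n). S k x = R g x"
proof -
  obtain t b where t: "t \<in> T n" "b \<in> B n" "x = S t b" "\<alpha> n t b + g \<in> F n"
    using n(2) unfolding stay_R_def by (auto elim: cellsE)
  obtain t' where t': "t' \<in> T n" "\<alpha> n t' b = \<alpha> n t b + g"
    using bij_betw_imp_surj_on[OF \<alpha>_bij[OF n(1) t(2)]] t(4) by (metis imageE)
  have "shift n g x (S t' b)"
    unfolding tile_shift_def using t t' by (metis add_diff_cancel_left')
  moreover have "x \<in> settled n" using n(2) by (simp add: stay_R_def)
  ultimately have "R g x = S t' b" by (intro settled_R[OF x n(1)])
  also have "\<dots> = S (t' - t) x"
    using t(3) B_space[OF n(1) t(2)] by (simp add: pmp_add[OF S, symmetric])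
  finally show ?thesis using t(1) t'(1) by force
qed

text \<open>One inclusion is read off from \<open>stay_S\<close>. For the other,
  \<open>R g x\<close> lies in the column of x at some stage, hence in its
  \<open>S\<close>-orbit.\<close>

lemma AE_same_orbits: "AE x in M. range (\<lambda>k. S k x) = range (\<lambda>g. R g x)"
  using AE_shift AE_stay_S
proof eventually_elim
  case (elim x)
  have "\<exists>h. S k x = R h x" for k using R_eq_S[OF elim(1)] elim(2) by metis
  moreover have "\<exists>k. R g x = S k x" for g
  proof -
    have "\<forall>\<^sub>F n in sequentially. n \<ge> 1 \<and> shift n g x (R g x)"
      by (intro eventually_conj eventually_ge_at_top elim(1)[rule_format])
    then obtain n where "n \<ge> 1" "shift n g x (R g x)" by (auto dest: eventually_happens)
    then show ?thesis by (rule shift_orbit)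
  qed
  ultimately show ?case by (auto simp: image_iff)
qed

text \<open>Freeness makes the solution h unique, so the cocycle equals it. The maps are kept
  abstract to serve both cocycles.\<close>

lemma prob_cocycle_notin:
  fixes S' :: "'g::group_add \<Rightarrow> 'a \<Rightarrow> 'a" and R' :: "'h::group_add \<Rightarrow> 'a \<Rightarrow> 'a"
  assumes X: "X \<in> sets M" and R': "pmp_action M R'" "free_action M R'"
    and ex: "AE x in M. x \<in> X \<longrightarrow> (\<exists>h\<in>V. R' h x = S' g x)"
  shows "prob {x \<in> space M. cocycle S' R' x g \<notin> V} \<le> prob (space M - X)"
proof (rule finite_measure_mono_AE)
  show "AE x in M. x \<in> {x \<in> space M. cocycle S' R' x g \<notin> V} \<longrightarrow> x \<in> space M - X"
    using ex R'(2)[unfolded free_action_def] AE_space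
  proof eventually_elim
    case (elim x)
    have "cocycle S' R' x g \<in> V" if xX: "x \<in> X"
    proof -
      obtain h where h: "h \<in> V" "R' h x = S' g x" using elim(1) xX by blast
      then have "cocycle S' R' x g = h"
        using pmp_free_inj[OF R'(1) elim(3) elim(2)] by (intro cocycle_eqI) auto
      with h show ?thesis by simp
    qed
    then show ?case by auto
  qed
qed (use X in auto)

lemma shannon_orbit_equivalence:
  assumes std: "standard_prob_space M"
  shows "shannon_orbit_equivalence_id M S R"
  unfolding shannon_orbit_equivalence_id_def orbit_equivalence_id_def
proof (intro conjI allI free_S free_R AE_same_orbits)
  show mS: "(\<lambda>x. cocycle S R x k) \<in> measurable M (count_space UNIV)" for k
    by (rule cocycle_measurable[OF std S R])
  show mR: "(\<lambda>x. cocycle R S x g) \<in> measurable M (count_space UNIV)" for g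
    by (rule cocycle_measurable[OF std R S])
  show "partition_entropy M (\<lambda>x. cocycle S R x k) < \<infinity>" for k
  \<comment> \<open>The values of this cocycle are differences of labels, hence of elements of the
    tile.\<close>
  proof (rule entropy_finite[OF mS, where D = F])
    fix n :: nat assume n: "n \<ge> 1"
    have "AE x in M. x \<in> stay_S k n \<longrightarrow> (\<exists>h\<in>(\<lambda>(d, e). d - e) ` (F n \<times> F n). R h x = S k x)"
      using AE_shift by eventually_elim (blast intro: R_eq_S[OF _ n])
    from prob_cocycle_notin[where S' = S and g = k, OF stay_S_sets[OF n] R free_R this]
    show "prob {x \<in> space M. cocycle S R x k \<notin> (\<lambda>(d, e). d - e) ` (F n \<times> F n)} \<le>
        (9 + 2 * \<bar>real_of_int k\<bar>) / 2 ^ n"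
      by (rule order_trans) (rule prob_not_stay_S[OF n])
  qed (auto simp: finite_F card_F)
  show "partition_entropy M (\<lambda>x. cocycle R S x g) < \<infinity>" for g
  \<comment> \<open>The values of this cocycle are differences of levels of one column.\<close>
  proof (rule entropy_finite[OF mR, where D = T])
    fix n :: nat assume n: "n \<ge> 1"
    have "AE x in M. x \<in> stay_R g n \<longrightarrow> (\<exists>h\<in>(\<lambda>(d, e). d - e) ` (T n \<times> T n). S h x = R g x)"
      using AE_shift by eventually_elim (blast intro: S_eq_R[OF _ n])
    from prob_cocycle_notin[where S' = R and g = g, OF stay_R_sets[OF n] S free_S this]
    show "prob {x \<in> space M. cocycle R S x g \<notin> (\<lambda>(d, e). d - e) ` (T n \<times> T n)} \<le>
        (9 + 2 * real (nat (\<bar>fst g\<bar> + \<bar>snd g\<bar>))) / 2 ^ n"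
      by (rule order_trans) (rule prob_not_stay_R[OF n])
  qed (auto simp: finite_T)
qed

end

theorem proposition4p7:
  fixes M :: "'a measure"
    and S :: "int \<Rightarrow> 'a \<Rightarrow> 'a"
    and R :: "int \<times> int \<Rightarrow> 'a \<Rightarrow> 'a"
    and \<epsilon> :: "nat \<Rightarrow> real"
    and T :: "nat \<Rightarrow> int set"
    and B :: "nat \<Rightarrow> 'a set"
    and F :: "nat \<Rightarrow> (int \<times> int) set"
    and \<alpha> :: "nat \<Rightarrow> int \<Rightarrow> 'a \<Rightarrow> int \<times> int"
    and \<A> :: "nat \<Rightarrow> 'a set set"
    and C :: "nat \<Rightarrow> (int \<times> int) set"
  assumes "standard_prob_space M" and "atomless M"
    and "pmp_action M S" and "ergodic_action M S"
    and "tower_system M S \<epsilon> T B F \<alpha> \<A> C"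
    and "induced_action M S T B \<alpha> R"
  shows "shannon_orbit_equivalence_id M S R"
proof -
  have "prob_space M"
    using assms(1) by (auto simp: standard_prob_space_def intro: prob_spaceI)
  then interpret tower_induced M S \<epsilon> T B F \<alpha> \<A> C R
    using assms(3,5,6)
    by (auto simp: tower_induced_def tower_induced_axioms_def tower_tiling_def tower_tiling_axioms_def)
  show ?thesis by (rule shannon_orbit_equivalence[OF assms(1)])
qed

end
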